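(* As a formal power series in $z$ with operator coefficients, $$\sum_{r\geq0}\mathcal G_r z^r=\exp\bigl(-\log(1-\delta z)\,E\bigr).$$ Consequently, for every $r\geq1$, $$\mathcal G_r=\frac{\delta^r}{r!}E(E+1)\cdots(E+r-1).$$ Equivalently, on $\mathbb Q[x,y]$, $$r!\,\mathcal G_r=\prod_{j=0}^{r-1}\bigl(xyD+j(y-x)\bigr),$$ where $y-x$ acts by multiplication. In particular, the operators $\mathcal G_r$ commute pairwise.
   Context: Work over $\mathbb Q$. Let $D=\partial_x+\partial_y$, $\mathcal G_0=\mathrm{id}$ and, for $r\geq1$, $\mathcal G_r=y^r\sum_{j=1}^{r}\binom{r-1}{j-1}\frac{x^j}{j!}D^j$. These are differential operators with polynomial coefficients; they act on $\mathbb Q[x,y]$ and on $\mathbb Q(x,y)$. Put $\delta=y-x$ and $u=x/y$, so that $\mathbb Q(x,y)=\mathbb Q(\delta,u)$ with $x=\delta u/(1-u)$, $y=\delta/(1-u)$. $E=u\partial_u$ is the $\mathbb Q$-derivation of $\mathbb Q(\delta,u)$ with $E(\delta)=0$, $E(u)=u$; $\delta$ also denotes the operator of multiplication by $\delta$ (it commutes with $E$). The exponential is $\exp(a(z)E)=\sum_{n\geq0}a(z)^nE^n/n!$ with $a(z)=-\log(1-\delta z)=\sum_{m\ge1}\delta^m z^m/m$; for each power of $z$ only finitely many $n$ contribute. The identities involving $E$ are identities of operators $\mathbb Q[x,y]\to\mathbb Q(x,y)$ (coefficientwise in $z$), where powers of $E$ are computed in $\mathbb Q(x,y)=\mathbb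 Q(\delta,u)$. *)

theory Defs
  imports
    "HOL-Computational_Algebra.Polynomial_Factorial"
    "HOL-Computational_Algebra.Formal_Power_Series"
begin

section \<open>The rings \<open>\<rat>[x,y]\<close> and \<open>\<rat>(x,y)\<close>\<close>

text \<open>In \<open>rat poly poly\<close> the inner indeterminate is \<open>x\<close> and the outer one is \<open>y\<close>.\<close>

type_synonym rat_xy = "rat poly poly"
type_synonym ratfun_xy = "rat poly poly fract"

instance fract :: ("{idom,ring_char_0}") field_char_0
proof
  show "inj (of_nat :: nat \<Rightarrow> 'a fract)"
    by (rule injI) (simp add: of_nat_fract eq_fract)
qed

definition const_xy :: "rat \<Rightarrow> rat_xy" where "const_xy c = [:[:c:]:]"
definition X :: rat_xy where "X = [:[:0, 1:]:]"
definition Y :: rat_xy where "Y = [:0, 1:]"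

abbreviation const_fr :: "rat \<Rightarrow> ratfun_xy" where "const_fr c \<equiv> to_fract (const_xy c)"
abbreviation X_fr :: ratfun_xy where "X_fr \<equiv> to_fract X"
abbreviation Y_fr :: ratfun_xy where "Y_fr \<equiv> to_fract Y"

definition \<delta> :: ratfun_xy where "\<delta> = Y_fr - X_fr"
definition u :: ratfun_xy where "u = X_fr / Y_fr"


section \<open>Derivations\<close>

definition partial_x :: "rat_xy \<Rightarrow> rat_xy" where "partial_x p = map_poly pderiv p"
definition partial_y :: "rat_xy \<Rightarrow> rat_xy" where "partial_y p = pderiv p"

definition D :: "rat_xy \<Rightarrow> rat_xy" where "D p = partial_x p + partial_y p"

text \<open>The extension of a derivation to the fraction field by the quotient rule; for a
  derivation the value does not depend on the fraction chosen, see \<open>quotient_rule_Fract\<close>.\<close>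

definition quotient_rule :: "(rat_xy \<Rightarrow> rat_xy) \<Rightarrow> ratfun_xy \<Rightarrow> ratfun_xy" where
  "quotient_rule d f =
     (SOME g. \<exists>a b. b \<noteq> 0 \<and> f = Fract a b \<and> g = Fract (d a * b - a * d b) (b ^ 2))"

definition D_fr :: "ratfun_xy \<Rightarrow> ratfun_xy" where
  "D_fr f = quotient_rule partial_x f + quotient_rule partial_y f"

definition Q_derivation :: "(ratfun_xy \<Rightarrow> ratfun_xy) \<Rightarrow> bool" where
  "Q_derivation d \<longleftrightarrow>
     (\<forall>f g. d (f + g) = d f + d g) \<and>
     (\<forall>f g. d (f * g) = d f * g + f * d g) \<and>
     (\<forall>c. d (const_fr c) = 0)"

text \<open>The operator \<open>u \<partial>\<^sub>u\<close> in the coordinates \<open>(\<delta>, u)\<close>; it is well defined by \<open>ex1_E\<close>.\<close>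

definition E :: "ratfun_xy \<Rightarrow> ratfun_xy" where
  "E = (THE d. Q_derivation d \<and> d \<delta> = 0 \<and> d u = u)"


section \<open>The operators \<open>\<G>\<^sub>r\<close>\<close>

text \<open>One formula for both actions: \<open>c\<close> is the embedding of the rationals into the ring acted
  on, \<open>x\<close> and \<open>y\<close> are the indeterminates and \<open>d\<close> is \<open>\<partial>\<^sub>x + \<partial>\<^sub>y\<close>.\<close>

definition G_formula ::
  "(rat \<Rightarrow> 'a::comm_ring_1) \<Rightarrow> 'a \<Rightarrow> 'a \<Rightarrow> ('a \<Rightarrow> 'a) \<Rightarrow> nat \<Rightarrow> 'a \<Rightarrow> 'a" where
  "G_formula c x y d r f =
     (if r = 0 then f
      else y ^ r * (\<Sum>j=1..r. c (of_nat ((r - 1) choose (j - 1)) / fact j) * x ^ j * (d ^^ j) f))"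

definition G :: "nat \<Rightarrow> rat_xy \<Rightarrow> rat_xy" where
  "G = G_formula const_xy X Y D"

definition G_fr :: "nat \<Rightarrow> ratfun_xy \<Rightarrow> ratfun_xy" where
  "G_fr = G_formula const_fr X_fr Y_fr D_fr"


section \<open>Products and exponentials of operators\<close>

text \<open>\<open>op_prod F r = F 0 \<circ> F 1 \<circ> \<dots> \<circ> F (r - 1)\<close>\<close>

definition op_prod :: "(nat \<Rightarrow> 'a \<Rightarrow> 'a) \<Rightarrow> nat \<Rightarrow> 'a \<Rightarrow> 'a" where
  "op_prod F r = foldr (\<circ>) (map F [0..<r]) id"

text \<open>\<open>exp(a(z) T) = \<Sum>\<^sub>n a(z)\<^sup>n T\<^sup>n / n!\<close> as a power series whose coefficients are operators,
  for a power series \<open>a(z)\<close> without constant term. The index set in the coefficient of \<open>z\<^sup>r\<close>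
  is then finite, see \<open>finite_contributing\<close>.\<close>

definition op_exp :: "'a::field_char_0 fps \<Rightarrow> ('a \<Rightarrow> 'a) \<Rightarrow> ('a \<Rightarrow> 'a) fps" where
  "op_exp a T = Abs_fps (\<lambda>r f. \<Sum>n | fps_nth (a ^ n) r \<noteq> 0. fps_nth (a ^ n) r * (T ^^ n) f / fact n)"

lemma finite_contributing:
  fixes a :: "'a::field_char_0 fps"
  assumes "fps_nth a 0 = 0"
  shows "finite {n. fps_nth (a ^ n) r \<noteq> 0}"
proof (rule finite_subset)
  show "{n. fps_nth (a ^ n) r \<noteq> 0} \<subseteq> {..r}"
  proof
    fix n assume "n \<in> {n. fps_nth (a ^ n) r \<noteq> 0}"
    then show "n \<in> {..r}"
      using startsby_zero_power_prefix[OF assms, of n] by (cases "r < n") auto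
  qed
qed simp

text \<open>\<open>a(z) = - log(1 - \<delta> z)\<close>; \<open>fps_ln 1\<close> is the series of \<open>log(1 + z)\<close>.\<close>

definition neg_log :: "ratfun_xy fps" where
  "neg_log = - (fps_ln 1 oo (- (fps_const \<delta> * fps_X)))"

lemma neg_log_nth: "fps_nth neg_log m = (if m = 0 then 0 else \<delta> ^ m / of_nat m)"
proof -
  have "- (fps_const \<delta> * fps_X) = fps_const (- \<delta>) * fps_X"
    by (simp flip: fps_const_neg)
  then have "fps_nth (fps_ln 1 oo (- (fps_const \<delta> * fps_X))) m = (- \<delta>) ^ m * fps_nth (fps_ln 1) m"
    by (simp add: fps_nth_compose_linear)
  moreover have "(- \<delta>) ^ m * (- 1) ^ (m - 1) = - (\<delta> ^ m)" if "m \<noteq> 0"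
  proof -
    have "(- \<delta>) ^ m * (- 1) ^ (m - 1) = \<delta> ^ m * ((- 1) ^ m * (- 1) ^ (m - 1))"
      by (simp only: power_minus[of \<delta>] mult_ac)
    also have "(- 1) ^ m * (- 1) ^ (m - 1) = (- 1 :: ratfun_xy)"
      using that by (cases m) (simp_all flip: power_mult_distrib)
    finally show ?thesis by simp
  qed
  ultimately show ?thesis
    by (auto simp: neg_log_def fps_ln_nth)
qed


section \<open>Existence and uniqueness of \<open>E\<close>\<close>

lemma pderiv_sum: "pderiv (sum f A) = (\<Sum>i\<in>A. pderiv (f i))"
  by (induction A rule: infinite_finite_induct) (simp_all add: pderiv_add)

lemma partial_x_add: "partial_x (p + q) = partial_x p + partial_x q"
  by (simp add: partial_x_def poly_eq_iff coeff_map_poly pderiv_add)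

lemma partial_x_mult: "partial_x (p * q) = partial_x p * q + p * partial_x q"
proof (rule poly_eqI)
  fix n
  have "pderiv (\<Sum>i\<le>n. coeff p i * coeff q (n - i)) =
    (\<Sum>i\<le>n. pderiv (coeff p i) * coeff q (n - i)) + (\<Sum>i\<le>n. coeff p i * pderiv (coeff q (n - i)))"
    by (simp add: pderiv_mult pderiv_sum sum.distrib mult.commute add.commute)
  then show "coeff (partial_x (p * q)) n = coeff (partial_x p * q + p * partial_x q) n"
    by (simp add: partial_x_def coeff_map_poly coeff_mult)
qed

lemma partial_y_mult: "partial_y (p * q) = partial_y p * q + p * partial_y q"
  by (simp add: partial_y_def pderiv_mult mult.commute add.commute)

lemma D_add: "D (p + q) = D p + D q"
  by (simp add: D_def partial_x_add partial_y_def pderiv_add)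

lemma D_mult: "D (p * q) = D p * q + p * D q"
  by (simp add: D_def partial_x_mult partial_y_def pderiv_mult algebra_simps)

lemma quotient_rule_Fract:
  assumes mult: "\<And>p q. d (p * q) = d p * q + p * d q" and b: "b \<noteq> 0"
  shows "quotient_rule d (Fract a b) = Fract (d a * b - a * d b) (b ^ 2)"
proof -
  define P where "P g \<longleftrightarrow> (\<exists>a' b'. b' \<noteq> 0 \<and> Fract a b = Fract a' b' \<and>
      g = Fract (d a' * b' - a' * d b') (b' ^ 2))" for g
  have "P (Fract (d a * b - a * d b) (b ^ 2))"
    unfolding P_def using b by blast
  then have "P (quotient_rule d (Fract a b))"
    unfolding quotient_rule_def P_def[symmetric] by (rule someI)
  then obtain a' b' where b': "b' \<noteq> 0" and "Fract a b = Fract a' b'"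
    and q: "quotient_rule d (Fract a b) = Fract (d a' * b' - a' * d b') (b' ^ 2)"
    unfolding P_def by blast
  then have e: "a' * b = a * b'" using b b' by (simp add: eq_fract)
  then have "d (a' * b) = d (a * b')" by simp
  then have e2: "d a' * b + a' * d b = d a * b' + a * d b'" by (simp add: mult)
  have "(d a' * b' - a' * d b') * b ^ 2 - (d a * b - a * d b) * b' ^ 2 =
     b * b' * ((d a' * b + a' * d b) - (d a * b' + a * d b'))
     - (b' * d b + b * d b') * (a' * b - a * b')"
    by (simp add: algebra_simps power2_eq_square)
  then have "(d a' * b' - a' * d b') * b ^ 2 = (d a * b - a * d b) * b' ^ 2"
    unfolding e e2 by simp
  then show ?thesis using b b' by (simp add: q eq_fract)
qed

lemma D_fr_Fract:
  assumes "b \<noteq> 0"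
  shows "D_fr (Fract a b) = Fract (D a * b - a * D b) (b ^ 2)"
proof -
  have *: "Fract p c + Fract q c = Fract (p + q) c" if "c \<noteq> 0" for p q c :: rat_xy
    using that by (simp add: eq_fract distrib_right mult.assoc)
  have "D a * b - a * D b =
      (partial_x a * b - a * partial_x b) + (partial_y a * b - a * partial_y b)"
    by (simp add: D_def algebra_simps)
  moreover have "D_fr (Fract a b) = Fract (partial_x a * b - a * partial_x b) (b ^ 2) +
      Fract (partial_y a * b - a * partial_y b) (b ^ 2)"
    unfolding D_fr_def using assms
    by (simp add: quotient_rule_Fract partial_x_mult partial_y_mult del: add_fract)
  ultimately show ?thesis
    using assms *[of "b ^ 2"] by (simp del: add_fract)
qed

lemma D_fr_eqI:
  assumes "b \<noteq> 0" "f * to_fract b = to_fract a"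
    and "z * to_fract b + f * to_fract (D b) = to_fract (D a)"
  shows "D_fr f = z"
proof -
  have b: "to_fract b \<noteq> 0" using assms(1) by simp
  have f: "f = Fract a b"
    using assms(1,2) by (simp add: Fract_conv_to_fract eq_divide_eq)
  have "D_fr f = (to_fract (D a) * to_fract b - to_fract a * to_fract (D b)) / to_fract b ^ 2"
    unfolding f D_fr_Fract[OF assms(1)] by (simp add: Fract_conv_to_fract power2_eq_square)
  also have "\<dots> = z * to_fract b ^ 2 / to_fract b ^ 2"
    unfolding assms(2,3)[symmetric] by (simp add: algebra_simps power2_eq_square)
  also have "\<dots> = z" using b by simp
  finally show ?thesis .
qed

lemma D_fr_times_denom:
  assumes "b \<noteq> 0" "f * to_fract b = to_fract a"
  shows "D_fr f * to_fract b + f * to_fract (D b) = to_fract (D a)"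
proof -
  define z where "z = (to_fract (D a) - f * to_fract (D b)) / to_fract b"
  have z: "z * to_fract b + f * to_fract (D b) = to_fract (D a)"
    using assms(1) by (simp add: z_def)
  with D_fr_eqI[OF assms z] show ?thesis by simp
qed

lemma D_const: "D (const_xy c) = 0" and D_X: "D X = 1" and D_Y: "D Y = 1" and D_1: "D 1 = 0"
  by (simp_all add: D_def partial_x_def partial_y_def const_xy_def X_def Y_def map_poly_pCons
      pderiv_pCons one_pCons)

lemma D_fr_to_fract: "D_fr (to_fract p) = to_fract (D p)"
  by (simp add: to_fract_def D_fr_Fract D_1)

lemma Q_derivation_D_fr: "Q_derivation D_fr"
  unfolding Q_derivation_def
proof (intro conjI allI)
  fix f g :: ratfun_xy
  obtain a b where "f = Fract a b" and b: "b \<noteq> 0" by (cases f) auto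
  then have f: "f * to_fract b = to_fract a" by (simp add: Fract_conv_to_fract)
  obtain a' b' where "g = Fract a' b'" and b': "b' \<noteq> 0" by (cases g) auto
  then have g: "g * to_fract b' = to_fract a'" by (simp add: Fract_conv_to_fract)
  note da = D_fr_times_denom[OF b f, symmetric] and da' = D_fr_times_denom[OF b' g, symmetric]
  show "D_fr (f + g) = D_fr f + D_fr g"
  proof (rule D_fr_eqI)
    show "b * b' \<noteq> 0" using b b' by simp
    show "(f + g) * to_fract (b * b') = to_fract (a * b' + a' * b)"
      by (simp add: algebra_simps flip: f g)
    show "(D_fr f + D_fr g) * to_fract (b * b') + (f + g) * to_fract (D (b * b')) =
        to_fract (D (a * b' + a' * b))"
      by (simp add: D_add D_mult da da' algebra_simps flip: f g)
  qed
  show "D_fr (f * g) = D_fr f * g + f * D_fr g"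
  proof (rule D_fr_eqI)
    show "b * b' \<noteq> 0" using b b' by simp
    show "(f * g) * to_fract (b * b') = to_fract (a * a')"
      by (simp add: algebra_simps flip: f g)
    show "(D_fr f * g + f * D_fr g) * to_fract (b * b') + (f * g) * to_fract (D (b * b')) =
        to_fract (D (a * a'))"
      by (simp add: D_mult da da' algebra_simps flip: f g)
  qed
qed (simp add: D_fr_to_fract D_const)

lemma Q_derivation_unique:
  assumes d: "Q_derivation d" "Q_derivation d'" and eq: "d X_fr = d' X_fr" "d Y_fr = d' Y_fr"
  shows "d = d'"
proof
  have x: "to_fract [:pCons c p:] = const_fr c + X_fr * to_fract [:p:]" for c p
    by (simp add: X_def const_xy_def flip: to_fract_mult to_fract_add)
  have y: "to_fract (pCons p q) = to_fract [:p:] + Y_fr * to_fract q" for p q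
    by (simp add: Y_def flip: to_fract_mult to_fract_add)
  have const: "d (to_fract 0) = d' (to_fract 0)"
  proof -
    have "d (const_fr 0) = d' (const_fr 0)" using d by (simp add: Q_derivation_def)
    then show ?thesis by (simp add: const_xy_def)
  qed
  have px: "d (to_fract [:p:]) = d' (to_fract [:p:])" for p
  proof (induction p)
    case 0 show ?case using const by simp
  next
    case (pCons c p) show ?case
      unfolding x[of c p] using d eq pCons.IH by (simp add: Q_derivation_def)
  qed
  have p: "d (to_fract p) = d' (to_fract p)" for p
  proof (induction p)
    case 0 show ?case using const .
  next
    case (pCons c p) show ?case
      unfolding y[of c p] using d eq pCons.IH px by (simp add: Q_derivation_def)
  qed
  fix f :: ratfun_xy
  obtain a b where f: "f = Fract a b" "b \<noteq> 0" by (cases f) auto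
  then have b: "to_fract b \<noteq> 0" and fb: "f * to_fract b = to_fract a"
    by (simp_all add: Fract_conv_to_fract)
  have "d (f * to_fract b) = d' (f * to_fract b)" unfolding fb by (rule p)
  then have "d f * to_fract b = d' f * to_fract b"
    using d p[of b] by (simp add: Q_derivation_def)
  then show "d f = d' f" using b by simp
qed

lemma X_neq_Y: "X_fr \<noteq> Y_fr" and Y_neq_0: "Y_fr \<noteq> 0"
  by (simp_all add: X_def Y_def)

lemma ex1_E: "\<exists>!d. Q_derivation d \<and> d \<delta> = 0 \<and> d u = u"
proof (rule ex_ex1I)
  let ?w = "X_fr * Y_fr / \<delta>"
  let ?d = "\<lambda>f. ?w * D_fr f"
  have der: "Q_derivation ?d"
    using Q_derivation_D_fr by (simp add: Q_derivation_def algebra_simps add_divide_distrib)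
  have "D_fr (X_fr + \<delta>) = D_fr X_fr + D_fr \<delta>"
    using Q_derivation_D_fr by (simp add: Q_derivation_def)
  then have "?d \<delta> = 0" by (simp add: \<delta>_def D_fr_to_fract D_X D_Y)
  moreover have "?d u = u"
  proof -
    have "D_fr (u * Y_fr) = D_fr u * Y_fr + u * D_fr Y_fr"
      using Q_derivation_D_fr by (simp add: Q_derivation_def)
    then have "D_fr u * Y_fr = 1 - u"
      using Y_neq_0 by (simp add: u_def D_fr_to_fract D_X D_Y)
    then have "D_fr u = \<delta> / Y_fr ^ 2"
      using Y_neq_0 by (simp add: u_def \<delta>_def field_simps power2_eq_square)
    moreover have "\<delta> \<noteq> 0" using X_neq_Y by (simp add: \<delta>_def)
    ultimately show ?thesis
      using Y_neq_0 by (simp add: u_def power2_eq_square)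
  qed
  ultimately show "\<exists>d. Q_derivation d \<and> d \<delta> = 0 \<and> d u = u" using der by blast
next
  have val: "d X_fr = d Y_fr \<and> d Y_fr * (1 - u) = X_fr"
    if d: "Q_derivation d" "d \<delta> = 0" "d u = u" for d
  proof -
    have "d (X_fr + \<delta>) = d X_fr + d \<delta>" "d (u * Y_fr) = d u * Y_fr + u * d Y_fr"
      using d(1) unfolding Q_derivation_def by blast+
    then show ?thesis
      using d Y_neq_0 by (simp add: \<delta>_def u_def algebra_simps)
  qed
  have "1 - u \<noteq> 0" using X_neq_Y Y_neq_0 by (simp add: u_def)
  fix d d'
  assume "Q_derivation d \<and> d \<delta> = 0 \<and> d u = u" "Q_derivation d' \<and> d' \<delta> = 0 \<and> d' u = u"
  then show "d = d'"
    using val[of d] val[of d'] \<open>1 - u \<noteq> 0\<close> 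
    by (metis Q_derivation_unique mult_right_cancel)
qed

lemma E: "Q_derivation E" "E \<delta> = 0" "E u = u"
  using theI'[OF ex1_E] by (simp_all add: E_def)

end

theory Submission
  imports Defs
begin

text \<open>
  Put \<open>A\<^sub>j = xyD + j(y - x)\<close>. The coefficients of \<open>\<G>\<^sub>r\<close> satisfy a Pascal-type recurrence that amounts to
  \<open>(r + 1) \<G>\<^sub>r\<^sub>+\<^sub>1 = A\<^sub>r \<G>\<^sub>r\<close>. Since \<open>D\<close> kills \<open>y - x\<close>, the \<open>A\<^sub>j\<close> commute, and this gives both the product
  formula and the commutation of the \<open>\<G>\<^sub>r\<close>. On \<open>\<rat>(x,y)\<close> one has \<open>xyD = \<delta>E\<close>, so
  \<open>(r + 1) \<G>\<^sub>r\<^sub>+\<^sub>1 = \<delta>(\<G>\<^sub>r E + r \<G>\<^sub>r)\<close>. The coefficients of the exponential satisfy the same recurrence,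
  because \<open>a = - log(1 - \<delta>z)\<close> solves \<open>(1 - \<delta>z) a' = \<delta>\<close>.
\<close>

section \<open>Products of operators\<close>

lemma op_prod_0 [simp]: "op_prod F 0 = id"
  by (simp add: op_prod_def)

lemma op_prod_Suc: "op_prod F (Suc r) = op_prod F r \<circ> F r"
proof -
  have "foldr (\<circ>) fs g = foldr (\<circ>) fs id \<circ> g" for fs and g :: "'a \<Rightarrow> 'a"
    by (induction fs) (simp_all add: o_assoc)
  from this[of "map F [0..<r]" "F r"] show ?thesis
    by (simp add: op_prod_def)
qed

section \<open>The recurrence for \<open>\<G>\<^sub>r\<close>\<close>

text \<open>The coefficient of \<open>y^r x^j D^j\<close> in the operator of index \<open>r\<close>.
  The clauses at 0 absorb the special case \<open>r = 0\<close> and let sums start at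
  \<open>j = 0\<close>.\<close>

fun G_coeff :: "nat \<Rightarrow> nat \<Rightarrow> rat" where
  "G_coeff 0 0 = 1"
| "G_coeff 0 (Suc j) = 0"
| "G_coeff (Suc r) 0 = 0"
| "G_coeff (Suc r) (Suc j) = of_nat (r choose j) / fact (Suc j)"

lemma G_coeff_eq_0: "r < j \<Longrightarrow> G_coeff r j = 0"
  by (cases r; cases j) simp_all

lemma G_coeff_Suc_0: "of_nat (Suc r) * G_coeff (Suc r) 0 = of_nat (r + 0) * G_coeff r 0"
  by (cases r) simp_all

lemma G_coeff_Suc_Suc:
  "of_nat (Suc r) * G_coeff (Suc r) (Suc j) = of_nat (r + Suc j) * G_coeff r (Suc j) + G_coeff r j"
proof (cases r)
  case 0
  then show ?thesis by (cases j) simp_all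
next
  case (Suc n)
  show ?thesis
  proof (cases j)
    case 0
    then show ?thesis using Suc by simp
  next
    case (Suc k)
    \<comment> \<open>Once factorials are cleared and Pascal's rule is applied, exactly this
      absorption identity remains.\<close>
    have "Suc k * (n choose Suc k) + k * (n choose k) = n * (n choose k)"
      using Suc_times_binomial_eq[of n k] by (simp add: algebra_simps)
    then have *: "of_nat (Suc k) * of_nat (n choose Suc k) + of_nat k * of_nat (n choose k)
        = (of_nat n * of_nat (n choose k) :: rat)"
      by (metis of_nat_add of_nat_mult)
    have f: "fact (Suc (Suc k)) = of_nat (Suc (Suc k)) * (fact (Suc k) :: rat)" by simp
    have nz: "of_nat (Suc (Suc k)) \<noteq> (0::rat)" "fact (Suc k) \<noteq> (0::rat)"
      by (simp_all only: of_nat_neq_0 fact_nonzero not_False_eq_True)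
    show ?thesis
      unfolding \<open>r = Suc n\<close> Suc G_coeff.simps f binomial_Suc_Suc
      using * nz by (simp add: divide_simps del: fact_Suc) (simp add: algebra_simps)
  qed
qed

section \<open>Derivations that kill constants and send \<open>x\<close> and \<open>y\<close> to 1:
  a common setting for both rings\<close>

locale translation_derivation =
  fixes c :: "rat \<Rightarrow> 'a::{comm_ring_1,ring_char_0}" and x y :: 'a and d :: "'a \<Rightarrow> 'a"
  assumes c_1: "c 1 = 1" and c_add: "c (a + b) = c a + c b" and c_mult: "c (a * b) = c a * c b"
    and d_add: "d (f + g) = d f + d g" and d_mult: "d (f * g) = d f * g + f * d g"
    and d_c: "d (c a) = 0" and d_x: "d x = 1" and d_y: "d y = 1"
begin

lemma c_0: "c 0 = 0"
  using c_add[of 0 0] by simp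

lemma c_of_nat: "c (of_nat n) = of_nat n"
  by (induction n) (simp_all add: c_0 c_1 c_add)

lemma d_0: "d 0 = 0"
  using d_add[of 0 0] by simp

lemma d_sum: "d (sum f S) = (\<Sum>i\<in>S. d (f i))"
  by (induction S rule: infinite_finite_induct) (simp_all add: d_0 d_add)

lemma d_of_nat: "d (of_nat n) = 0"
  using d_c[of "of_nat n"] by (simp add: c_of_nat)

lemma d_diff: "d (y - x) = 0"
  using d_add[of "y - x" x] d_x d_y by simp

text \<open>The factor \<open>z\<close> avoids the exponent \<open>n - 1\<close>.\<close>

lemma d_power: "d z = 1 \<Longrightarrow> z * d (z ^ n) = of_nat n * z ^ n"
proof (induction n)
  case 0
  then show ?case using d_of_nat[of 1] by simp
next
  case (Suc n)
  have "z * d (z ^ Suc n) = z * z ^ n + z * (z * d (z ^ n))"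
    using Suc.prems by (simp add: d_mult algebra_simps)
  then show ?case using Suc by (simp add: algebra_simps)
qed

abbreviation Gr :: "nat \<Rightarrow> 'a \<Rightarrow> 'a" where "Gr \<equiv> G_formula c x y d"

definition A :: "nat \<Rightarrow> 'a \<Rightarrow> 'a" where "A j f = x * y * d f + of_nat j * (y - x) * f"

lemma A_sum: "A j (sum f S) = (\<Sum>i\<in>S. A j (f i))"
  by (simp add: A_def d_sum sum_distrib_left sum.distrib)

lemma A_const: "d k = 0 \<Longrightarrow> A j (k * f) = k * A j f"
  by (simp add: A_def d_mult algebra_simps)

lemma A_commute: "A i (A j f) = A j (A i f)"
proof -
  \<comment> \<open>As \<open>d\<close> kills \<open>y - x\<close>, the expansion is symmetric in
    \<open>i\<close> and \<open>j\<close>.\<close>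
  have "A i (A j f) = x * y * d (x * y * d f) + of_nat (i + j) * (y - x) * (x * y * d f)
      + of_nat i * of_nat j * (y - x) * (y - x) * f" for i j
  proof -
    have "d (of_nat j * (y - x) * f) = of_nat j * (y - x) * d f"
      by (simp add: d_mult d_of_nat d_diff)
    then have "A i (A j f) = x * y * (d (x * y * d f) + of_nat j * (y - x) * d f)
        + of_nat i * (y - x) * (x * y * d f + of_nat j * (y - x) * f)"
      by (simp only: A_def d_add)
    then show ?thesis
      by (simp add: algebra_simps)
  qed
  from this[of i j] this[of j i] show ?thesis
    by (simp only: add.commute[of j i] mult.commute[of "of_nat j" "of_nat i"])
qed

lemma Gr_coeff: "Gr r f = (\<Sum>j\<le>r. c (G_coeff r j) * (y ^ r * x ^ j * (d ^^ j) f))"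
proof (cases r)
  case 0
  then show ?thesis by (simp add: G_formula_def c_1)
next
  case (Suc n)
  have "(\<Sum>j\<le>r. c (G_coeff r j) * (y ^ r * x ^ j * (d ^^ j) f))
      = (\<Sum>j=1..r. c (G_coeff r j) * (y ^ r * x ^ j * (d ^^ j) f))"
    \<comment> \<open>The term at \<open>j = 0\<close> vanishes because \<open>r\<close> is
      positive.\<close>
    by (intro sum.mono_neutral_right) (auto simp: Suc c_0 Suc_le_eq)
  also have "\<dots> = (\<Sum>j=1..r. y ^ r * (c (of_nat ((r - 1) choose (j - 1)) / fact j) * x ^ j * (d ^^ j) f))"
  proof (rule sum.cong)
    fix j assume "j \<in> {1..r}"
    then obtain k where "j = Suc k" by (cases j) auto
    then show "c (G_coeff r j) * (y ^ r * x ^ j * (d ^^ j) f)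
        = y ^ r * (c (of_nat ((r - 1) choose (j - 1)) / fact j) * x ^ j * (d ^^ j) f)"
      by (simp add: Suc mult_ac del: fact_Suc)
  qed simp
  finally show ?thesis
    using Suc by (simp only: G_formula_def sum_distrib_left nat.distinct if_False)
qed

text \<open>The part \<open>- r x\<close> of \<open>r (y - x)\<close> cancels what differentiating
  \<open>y^r\<close> produces, so every surviving term carries \<open>y^(r+1)\<close>.\<close>

lemma A_monomial:
  "A r (y ^ r * x ^ j * g) = of_nat (r + j) * (y ^ Suc r * x ^ j * g) + y ^ Suc r * x ^ Suc j * d g"
proof -
  have "A r (y ^ r * x ^ j * g) = x * (y * d (y ^ r)) * x ^ j * g + y * y ^ r * (x * d (x ^ j)) * g
      + x * y * y ^ r * x ^ j * d g + of_nat r * (y - x) * (y ^ r * x ^ j * g)"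
    by (simp add: A_def d_mult algebra_simps)
  then show ?thesis
    by (simp add: d_power d_x d_y algebra_simps)
qed

lemma Gr_Suc_left: "of_nat (Suc r) * Gr (Suc r) f = A r (Gr r f)"
proof -
  define T where "T j = y ^ Suc r * x ^ j * (d ^^ j) f" for j
  have "A r (Gr r f) = (\<Sum>j\<le>r. c (G_coeff r j) * (of_nat (r + j) * T j + T (Suc j)))"
    by (simp add: Gr_coeff A_sum A_const d_c A_monomial T_def del: of_nat_add power_Suc)
  also have "\<dots> = (\<Sum>j\<le>r. c (of_nat (r + j) * G_coeff r j) * T j)
      + (\<Sum>j\<le>r. c (G_coeff r j) * T (Suc j))"
    by (simp add: c_mult c_of_nat distrib_left sum.distrib mult_ac del: of_nat_add)
  \<comment> \<open>A zero term at \<open>Suc r\<close> is added, so that after an index shift both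
    sums run over the same \<open>T (Suc j)\<close>.\<close>
  also have "(\<Sum>j\<le>r. c (of_nat (r + j) * G_coeff r j) * T j)
      = (\<Sum>j\<le>Suc r. c (of_nat (r + j) * G_coeff r j) * T j)"
    by (simp add: G_coeff_eq_0 c_0)
  also have "\<dots> = c (of_nat (r + 0) * G_coeff r 0) * T 0
      + (\<Sum>j\<le>r. c (of_nat (r + Suc j) * G_coeff r (Suc j)) * T (Suc j))"
    by (rule sum.atMost_Suc_shift)
  also have "\<dots> + (\<Sum>j\<le>r. c (G_coeff r j) * T (Suc j))
      = c (of_nat (Suc r) * G_coeff (Suc r) 0) * T 0
      + (\<Sum>j\<le>r. c (of_nat (Suc r) * G_coeff (Suc r) (Suc j)) * T (Suc j))"
    by (simp only: G_coeff_Suc_0 G_coeff_Suc_Suc c_add distrib_right sum.distrib add.assoc)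
  also have "\<dots> = (\<Sum>j\<le>Suc r. c (of_nat (Suc r) * G_coeff (Suc r) j) * T j)"
    by (rule sum.atMost_Suc_shift[symmetric])
  also have "\<dots> = of_nat (Suc r) * Gr (Suc r) f"
    by (simp only: Gr_coeff T_def c_mult c_of_nat sum_distrib_left mult.assoc)
  finally show ?thesis ..
qed

text \<open>Division by \<open>r + 1\<close> goes through \<open>c\<close>, since the ring may fail
  to be a field.\<close>

lemma Gr_Suc: "Gr (Suc r) f = c (1 / of_nat (Suc r)) * A r (Gr r f)"
proof -
  have "c (1 / of_nat (Suc r)) * of_nat (Suc r) = c (1 / of_nat (Suc r) * of_nat (Suc r))"
    by (simp only: c_mult c_of_nat)
  also have "\<dots> = 1" by (simp add: c_1 del: of_nat_Suc)
  finally show ?thesis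
    by (simp only: Gr_Suc_left[symmetric] mult.assoc[symmetric] mult_1_left)
qed

lemma Gr_0 [simp]: "Gr 0 f = f"
  by (simp add: G_formula_def)

text \<open>By \<open>Gr_Suc\<close>, each \<open>Gr r\<close> is built from the identity by the
  \<open>A j\<close> and rational factors. Used with \<open>H\<close> an \<open>A j\<close>, a
  multiplication by a constant of \<open>d\<close>, and finally \<open>Gr r\<close> itself.\<close>

lemma commute_Gr:
  assumes "\<And>j f. H (A j f) = A j (H f)" and "\<And>a f. H (c a * f) = c a * H f"
  shows "H (Gr r f) = Gr r (H f)"
  by (induction r) (simp_all add: Gr_Suc assms)

lemma Gr_A: "Gr r (A j f) = A j (Gr r f)"
  using commute_Gr[of "A j"] by (simp add: A_commute A_const d_c)

lemma Gr_const: "d k = 0 \<Longrightarrow> Gr r (k * f) = k * Gr r f"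
  using commute_Gr[of "\<lambda>f. k * f"] by (simp add: A_const mult.left_commute)

lemma Gr_commute: "Gr r \<circ> Gr s = Gr s \<circ> Gr r"
  using commute_Gr[of "Gr r" s] by (simp add: fun_eq_iff Gr_A Gr_const d_c)

lemma Gr_add: "Gr r (f + g) = Gr r f + Gr r g"
  by (induction r) (simp_all add: Gr_Suc A_def d_add algebra_simps)

lemma fact_Gr: "fact r * Gr r f = op_prod A r f"
proof (induction r arbitrary: f)
  case (Suc r)
  have "fact (Suc r) * Gr (Suc r) f = fact r * (of_nat (Suc r) * Gr (Suc r) f)"
    by (simp add: mult_ac)
  \<comment> \<open>The recurrence has \<open>A r\<close> outermost, while
    \<open>op_prod_Suc\<close> splits off the innermost factor; \<open>Gr_A\<close> reconciles the
    two.\<close>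
  also have "\<dots> = fact r * Gr r (A r f)"
    by (simp only: Gr_Suc_left Gr_A)
  finally show ?case by (simp add: Suc.IH op_prod_Suc)
qed simp

end

section \<open>The two actions\<close>

lemma const_xy_add: "const_xy (a + b) = const_xy a + const_xy b"
  and const_xy_mult: "const_xy (a * b) = const_xy a * const_xy b"
  and const_xy_1: "const_xy 1 = 1"
  by (simp_all add: const_xy_def one_pCons)

interpretation poly: translation_derivation const_xy X Y D
  by unfold_locales
    (simp_all add: const_xy_add const_xy_mult const_xy_1 D_add D_mult D_const D_X D_Y)

interpretation frac: translation_derivation const_fr X_fr Y_fr D_fr
  using Q_derivation_D_fr
  by unfold_locales
    (simp_all add: const_xy_add const_xy_mult const_xy_1 D_X D_Y D_fr_to_fract Q_derivation_def)

section \<open>Passage from polynomials to rational functions\<close>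

lemma to_fract_sum: "to_fract (sum f S) = (\<Sum>i\<in>S. to_fract (f i))"
  by (induction S rule: infinite_finite_induct) simp_all

lemma to_fract_power: "to_fract (p ^ n) = to_fract p ^ n"
  by (induction n) simp_all

lemma to_fract_G: "to_fract (G r p) = G_fr r (to_fract p)"
proof -
  have "to_fract ((D ^^ j) p) = (D_fr ^^ j) (to_fract p)" for j
    by (induction j) (simp_all flip: D_fr_to_fract)
  then show ?thesis
    by (simp add: G_def G_fr_def G_formula_def to_fract_sum to_fract_power)
qed

section \<open>The exponential of \<open>E\<close>\<close>

lemma \<delta>_neq_0: "\<delta> \<noteq> 0"
  using X_neq_Y by (simp add: \<delta>_def)

text \<open>A derivation is determined by its values at \<open>x\<close> and \<open>y\<close>; those
  of \<open>E\<close> follow by applying it to \<open>y = x + \<delta>\<close> and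
  \<open>x = u y\<close>.\<close>

lemma \<delta>_E: "\<delta> * E f = X_fr * Y_fr * D_fr f"
proof -
  define w where "w = X_fr * Y_fr / \<delta>"
  have w: "\<delta> * w = X_fr * Y_fr" using \<delta>_neq_0 by (simp add: w_def)
  have "E (X_fr + \<delta>) = E X_fr + E \<delta>" "E (u * Y_fr) = E u * Y_fr + u * E Y_fr"
    using E(1) unfolding Q_derivation_def by blast+
  then have EY: "E Y_fr = E X_fr" and EX: "E X_fr = X_fr + u * E Y_fr"
    using E(2,3) Y_neq_0 by (simp_all add: \<delta>_def u_def)
  then have "\<delta> * E X_fr = X_fr * Y_fr"
    using Y_neq_0 by (simp add: \<delta>_def u_def field_simps)
  then have X: "E X_fr = w" using \<delta>_neq_0 by (simp add: w_def eq_divide_eq mult.commute)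
  have "E = (\<lambda>f. w * D_fr f)"
  proof (rule Q_derivation_unique)
    show "Q_derivation (\<lambda>f. w * D_fr f)"
      using Q_derivation_D_fr by (simp add: Q_derivation_def algebra_simps)
    show "E X_fr = w * D_fr X_fr" "E Y_fr = w * D_fr Y_fr"
      by (simp_all add: EY X D_fr_to_fract D_X D_Y)
  qed (rule E(1))
  then have "E f = w * D_fr f" by (rule fun_cong)
  then show ?thesis by (simp only: w mult.assoc[symmetric])
qed

lemma A_frac: "frac.A j f = \<delta> * (E f + of_nat j * f)"
  by (simp add: frac.A_def \<delta>_E \<delta>_def[symmetric] distrib_left mult_ac)

lemma D_fr_\<delta>: "D_fr \<delta> = 0"
  using frac.d_diff by (simp add: \<delta>_def)

lemma G_fr_\<delta>: "G_fr r (\<delta> * f) = \<delta> * G_fr r f"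
  unfolding G_fr_def by (rule frac.Gr_const[OF D_fr_\<delta>])

text \<open>\<open>A r\<close> is moved inside, to match the recurrence of the exponential, which
  also acts on the argument.\<close>

lemma G_fr_Suc: "of_nat (Suc r) * G_fr (Suc r) f = \<delta> * G_fr r (E f + of_nat r * f)"
  unfolding G_fr_\<delta>[symmetric] A_frac[symmetric]
  by (simp only: G_fr_def frac.Gr_Suc_left frac.Gr_A)

lemma fact_G_fr: "fact r * G_fr r f = \<delta> ^ r * op_prod (\<lambda>j f. E f + of_nat j * f) r f"
proof (induction r arbitrary: f)
  case 0
  then show ?case by (simp add: G_fr_def)
next
  case (Suc r)
  have "fact (Suc r) * G_fr (Suc r) f = fact r * (of_nat (Suc r) * G_fr (Suc r) f)"
    by (simp add: mult_ac)
  also have "\<dots> = \<delta> * (fact r * G_fr r (E f + of_nat r * f))"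
    by (simp only: G_fr_Suc mult_ac)
  finally show ?case by (simp add: Suc.IH op_prod_Suc mult_ac)
qed

section \<open>Coefficients of the powers of the logarithm\<close>

definition exp_coeff :: "nat \<Rightarrow> nat \<Rightarrow> ratfun_xy" where
  "exp_coeff r n = fps_nth (neg_log ^ n) r / fact n"

text \<open>The derivative is the geometric series with coefficients
  \<open>\<delta>^(m+1)\<close>.\<close>

lemma fps_deriv_neg_log: "(1 - fps_const \<delta> * fps_X) * fps_deriv neg_log = fps_const \<delta>"
proof (rule fps_ext)
  fix n
  have "fps_nth (fps_deriv neg_log) m = \<delta> ^ Suc m" for m
    by (simp add: neg_log_nth del: of_nat_Suc)
  then show "fps_nth ((1 - fps_const \<delta> * fps_X) * fps_deriv neg_log) n = fps_nth (fps_const \<delta>) n"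
    by (cases n) (simp_all add: left_diff_distrib mult.assoc del: fps_deriv_nth)
qed

text \<open>Compares coefficients of \<open>z^r\<close> in
  \<open>(1 - \<delta> z) (a^(n+1))' = (n+1) \<delta> a^n\<close>.\<close>

lemma neg_log_power_nth_Suc:
  "of_nat (Suc r) * fps_nth (neg_log ^ Suc n) (Suc r) =
     \<delta> * (of_nat r * fps_nth (neg_log ^ Suc n) r + of_nat (Suc n) * fps_nth (neg_log ^ n) r)"
proof -
  have "(1 - fps_const \<delta> * fps_X) * fps_deriv (neg_log ^ Suc n)
      = of_nat (Suc n) * neg_log ^ n * ((1 - fps_const \<delta> * fps_X) * fps_deriv neg_log)"
    by (simp only: fps_deriv_power diff_Suc_1 fps_of_nat mult_ac)
  also have "\<dots> = fps_const (of_nat (Suc n) * \<delta>) * neg_log ^ n"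
    unfolding fps_deriv_neg_log fps_of_nat[symmetric] fps_const_mult[symmetric] by (simp only: mult_ac)
  finally have "fps_nth ((1 - fps_const \<delta> * fps_X) * fps_deriv (neg_log ^ Suc n)) r
      = of_nat (Suc n) * \<delta> * fps_nth (neg_log ^ n) r"
    by (simp only: fps_mult_left_const_nth)
  moreover have "fps_nth ((1 - fps_const \<delta> * fps_X) * fps_deriv g) r
      = of_nat (Suc r) * fps_nth g (Suc r) - \<delta> * (of_nat r * fps_nth g r)" for g
    by (cases r) (simp_all add: left_diff_distrib mult.assoc)
  ultimately have "of_nat (Suc r) * fps_nth (neg_log ^ Suc n) (Suc r)
      - \<delta> * (of_nat r * fps_nth (neg_log ^ Suc n) r) = of_nat (Suc n) * \<delta> * fps_nth (neg_log ^ n) r"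
    by (simp only:)
  then show ?thesis
    by (simp only: diff_eq_eq distrib_left ac_simps)
qed

lemma exp_coeff_eq_0: "r < n \<Longrightarrow> exp_coeff r n = 0"
  using startsby_zero_power_prefix[of neg_log n] by (simp add: exp_coeff_def neg_log_nth)

lemma exp_coeff_Suc_0: "exp_coeff (Suc r) 0 = 0"
  by (simp add: exp_coeff_def)

text \<open>Up to the factor \<open>\<delta>^r / r!\<close>, the \<open>exp_coeff r n\<close> are
  the unsigned Stirling numbers of the first kind, and this is their recurrence.\<close>

lemma exp_coeff_Suc_Suc:
  "of_nat (Suc r) * exp_coeff (Suc r) (Suc n) = \<delta> * (of_nat r * exp_coeff r (Suc n) + exp_coeff r n)"
proof -
  have "of_nat (Suc r) * exp_coeff (Suc r) (Suc n) =
      \<delta> * (of_nat r * fps_nth (neg_log ^ Suc n) r + of_nat (Suc n) * fps_nth (neg_log ^ n) r) / fact (Suc n)"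
    by (simp only: exp_coeff_def times_divide_eq_right neg_log_power_nth_Suc)
  also have "\<dots> = \<delta> * (of_nat r * (fps_nth (neg_log ^ Suc n) r / fact (Suc n))
      + of_nat (Suc n) * fps_nth (neg_log ^ n) r / (of_nat (Suc n) * fact n))"
    by (simp only: fact_Suc add_divide_distrib distrib_left times_divide_eq_right)
  also have "of_nat (Suc n) * fps_nth (neg_log ^ n) r / (of_nat (Suc n) * fact n) = exp_coeff r n"
    unfolding exp_coeff_def by (rule mult_divide_mult_cancel_left) (rule of_nat_neq_0)
  finally show ?thesis by (simp only: exp_coeff_def)
qed

text \<open>Since \<open>neg_log\<close> has no constant term, its \<open>n\<close>-th power starts
  at \<open>z^n\<close> or later; this gives an explicit index range.\<close>

lemma op_exp_neg_log_nth:
  "fps_nth (op_exp neg_log T) r f = (\<Sum>n\<le>r. exp_coeff r n * (T ^^ n) f)"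
proof -
  have "fps_nth (op_exp neg_log T) r f
      = (\<Sum>n | fps_nth (neg_log ^ n) r \<noteq> 0. exp_coeff r n * (T ^^ n) f)"
    by (simp add: op_exp_def exp_coeff_def)
  also have "\<dots> = (\<Sum>n\<le>r. exp_coeff r n * (T ^^ n) f)"
  proof (rule sum.mono_neutral_left)
    show "{n. fps_nth (neg_log ^ n) r \<noteq> 0} \<subseteq> {..r}"
      using startsby_zero_power_prefix[of neg_log] by (force simp: neg_log_nth not_le[symmetric])
  qed (simp_all add: exp_coeff_def)
  finally show ?thesis .
qed

lemma op_exp_neg_log_Suc:
  "of_nat (Suc r) * fps_nth (op_exp neg_log T) (Suc r) f =
     \<delta> * (fps_nth (op_exp neg_log T) r (T f) + of_nat r * fps_nth (op_exp neg_log T) r f)"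
proof -
  have shift: "(T ^^ Suc n) f = (T ^^ n) (T f)" for n
    by (simp add: funpow_swap1)
  have "of_nat r * (\<Sum>n\<le>r. exp_coeff r n * (T ^^ n) f)
      = of_nat r * (\<Sum>n\<le>Suc r. exp_coeff r n * (T ^^ n) f)"
    by (simp add: exp_coeff_eq_0)
  also have "\<dots> = of_nat r * exp_coeff r 0 * f + of_nat r * (\<Sum>n\<le>r. exp_coeff r (Suc n) * (T ^^ n) (T f))"
    by (simp add: sum.atMost_Suc_shift shift distrib_left mult.assoc del: sum.atMost_Suc funpow.simps(2))
  \<comment> \<open>For \<open>r = 0\<close> the first factor vanishes, otherwise the
    second.\<close>
  also have "of_nat r * exp_coeff r 0 = 0"
    by (cases r) (simp_all add: exp_coeff_Suc_0)
  finally have r: "of_nat r * (\<Sum>n\<le>r. exp_coeff r n * (T ^^ n) f)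
      = of_nat r * (\<Sum>n\<le>r. exp_coeff r (Suc n) * (T ^^ n) (T f))" by simp
  have "of_nat (Suc r) * (\<Sum>n\<le>Suc r. exp_coeff (Suc r) n * (T ^^ n) f)
      = (\<Sum>n\<le>r. of_nat (Suc r) * exp_coeff (Suc r) (Suc n) * (T ^^ n) (T f))"
    by (simp add: sum.atMost_Suc_shift shift exp_coeff_Suc_0 sum_distrib_left mult.assoc
        del: sum.atMost_Suc funpow.simps(2) of_nat_Suc)
  also have "\<dots> = \<delta> * ((\<Sum>n\<le>r. exp_coeff r n * (T ^^ n) (T f))
      + of_nat r * (\<Sum>n\<le>r. exp_coeff r (Suc n) * (T ^^ n) (T f)))"
    unfolding exp_coeff_Suc_Suc
    by (simp add: sum_distrib_left distrib_left distrib_right sum.distrib mult_ac)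
  finally show ?thesis
    unfolding op_exp_neg_log_nth r .
qed

lemma G_fr_eq_op_exp: "G_fr r f = fps_nth (op_exp neg_log E) r f"
proof (induction r arbitrary: f)
  case 0
  show ?case by (simp add: G_fr_def op_exp_neg_log_nth exp_coeff_def)
next
  case (Suc r)
  \<comment> \<open>This lets \<open>Gr_const\<close> pull the factor \<open>r\<close> out of
    \<open>G_fr r\<close>.\<close>
  have "D_fr (of_nat r) = 0" by (rule frac.d_of_nat)
  then have "of_nat (Suc r) * G_fr (Suc r) f = \<delta> * (G_fr r (E f) + of_nat r * G_fr r f)"
    unfolding G_fr_Suc by (simp add: G_fr_def frac.Gr_add frac.Gr_const)
  also have "\<dots> = of_nat (Suc r) * fps_nth (op_exp neg_log E) (Suc r) f"
    unfolding Suc.IH op_exp_neg_log_Suc ..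
  finally show ?case
    using mult_left_cancel[OF of_nat_neq_0] by blast
qed

theorem theorem6:
  shows
    "Abs_fps (\<lambda>r p. to_fract (G r p)) = Abs_fps (\<lambda>r p. fps_nth (op_exp neg_log E) r (to_fract p))
     \<and> (\<forall>r\<ge>1. \<forall>p. to_fract (G r p) =
            \<delta> ^ r / fact r * op_prod (\<lambda>j f. E f + of_nat j * f) r (to_fract p))
     \<and> (\<forall>r\<ge>1. \<forall>p. fact r * G r p =
            op_prod (\<lambda>j q. X * Y * D q + of_nat j * (Y - X) * q) r p)
     \<and> (\<forall>r s. G r \<circ> G s = G s \<circ> G r)
     \<and> (\<forall>r s. G_fr r \<circ> G_fr s = G_fr s \<circ> G_fr r)"
proof (intro conjI allI impI)
  show "Abs_fps (\<lambda>r p. to_fract (G r p)) = Abs_fps (\<lambda>r p. fps_nth (op_exp neg_log E) r (to_fract p))"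
    by (simp add: to_fract_G G_fr_eq_op_exp)
  show "to_fract (G r p) = \<delta> ^ r / fact r * op_prod (\<lambda>j f. E f + of_nat j * f) r (to_fract p)" for r p
    using fact_G_fr[of r "to_fract p"] by (simp add: to_fract_G eq_divide_eq mult.commute)
  have "poly.A = (\<lambda>j q. X * Y * D q + of_nat j * (Y - X) * q)"
    by (simp add: fun_eq_iff poly.A_def)
  then show "fact r * G r p = op_prod (\<lambda>j q. X * Y * D q + of_nat j * (Y - X) * q) r p" for r p
    using poly.fact_Gr[of r p] by (simp add: G_def)
  show "G r \<circ> G s = G s \<circ> G r" for r s
    unfolding G_def by (rule poly.Gr_commute)
  show "G_fr r \<circ> G_fr s = G_fr s \<circ> G_fr r" for r s
    unfolding G_fr_def by (rule frac.Gr_commute)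
qed

end
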